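(* Let $\alpha\in\mathbb{R}$ and let $\hat\gamma\in C^2(2\pi\mathbb{T})$ be positive. Suppose that either $3\hat\gamma(\theta)-\hat\gamma(\theta-\pi)>0$ for all $\theta\in2\pi\mathbb{T}$, or $\alpha=-1$ and $3\hat\gamma(\theta)-\hat\gamma(\theta-\pi)\ge0$ for all $\theta\in2\pi\mathbb{T}$. Then the scheme (G) described in the context, for the velocity mapping $\mathfrak{F}$, is structure-preserving for sufficiently large $k$: there is a function $k_*:2\pi\mathbb{T}\to\mathbb{R}$, depending only on $\hat\gamma$ and $\alpha$, such that whenever $k(\theta)\ge k_*(\theta)$ for all $\theta$, every solution of (G) satisfies $$\frac{A^{m+1}-A^m}{\tau}=\bigl(\mathfrak{F}(\mu^{m+1},\Gamma^m),1\bigr)^h_{\Gamma^m},\qquad W^{m+1}\le W^m\le\cdots\le W^0,\qquad\forall\,m\ge0 .$$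
   Context: Notation: $2\pi\mathbb{T}=\mathbb{R}/2\pi\mathbb{Z}$. For $\theta\in2\pi\mathbb{T}$ let $\boldsymbol{n}(\theta)=(-\sin\theta,\cos\theta)^T$, $\boldsymbol{\tau}(\theta)=(\cos\theta,\sin\theta)^T$, and $\boldsymbol{\xi}(\theta)=\hat\gamma(\theta)\boldsymbol{n}(\theta)-\hat\gamma'(\theta)\boldsymbol{\tau}(\theta)$. For $\alpha\in\mathbb{R}$ and a stabilizing function $k:2\pi\mathbb{T}\to\mathbb{R}$, the $\alpha$-surface energy matrix is $$\hat{\boldsymbol{G}}_k^\alpha(\theta)=\hat\gamma(\theta)I_2-\boldsymbol{n}(\theta)\boldsymbol{\xi}(\theta)^T+\alpha\,\boldsymbol{\xi}(\theta)\boldsymbol{n}(\theta)^T+k(\theta)\boldsymbol{n}(\theta)\boldsymbol{n}(\theta)^T .$$ For $\boldsymbol{v}=(v_1,v_2)^T$, $\boldsymbol{v}^\perp=(v_2,-v_1)^T$ (clockwise rotation by $\pi/2$), so that $\boldsymbol{n}(\theta)=-\boldsymbol{\tau}(\theta)^\perp$. Discretization: $N>2$ is an integer, $h=1/N$, $\rho_j=jh$, $I_j=[\rho_{j-1},\rho_j]$, $\mathbb{I}=[0,1]$; $\mathbb{K}_p^h$ is the space of continuous functions $u$ on $\mathbb{I}$ that are affine on each $I_j$ and satisfy $u(0)=u(1)$. $\tau>0$ is the time step. The closed polygonal curve $\Gamma^m$ is given by $\boldsymbol{X}^m=(x^m,y^m)^T\in[\mathbb{K}_p^h]^2$, with $\boldsymbol{h}_j^m=\boldsymbol{X}^m(\rho_j)-\boldsymbol{X}^m(\rho_{j-1})$;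 throughout it is assumed that $\min_{1\le j\le N}|\boldsymbol{h}_j^m|>0$ for all $m$. On $I_j$, $\theta^m|_{I_j}=\theta_j^m$ is defined by $(\cos\theta_j^m,\sin\theta_j^m)^T=\boldsymbol{h}_j^m/|\boldsymbol{h}_j^m|$. For (scalar or vector valued, in the latter case with dot product) functions with one-sided limits at the nodes, $$(u,v)^h_{\Gamma^m}=\sum_{j=1}^N\frac{|\boldsymbol{h}_j^m|}{2}\bigl(u(\rho_j^-)v(\rho_j^-)+u(\rho_{j-1}^+)v(\rho_{j-1}^+)\bigr),$$ and $\partial_{s^m}f|_{I_j}=\dfrac{f(\rho_j)-f(\rho_{j-1})}{|\boldsymbol{h}_j^m|}$. Set $\boldsymbol{n}^{m+\frac12}=-\frac12(\partial_{s^m}\boldsymbol{X}^m+\partial_{s^m}\boldsymbol{X}^{m+1})^\perp$. Velocity mapping: $\mathfrak{F}$ assigns to each non-degenerate closed polygonal curve $\Gamma^m$ (that is, each closed polygonal curve given by some $\boldsymbol{X}^m\in[\mathbb{K}_p^h]^2$ with $\min_{1\le j\le N}|\boldsymbol{X}^m(\rho_j)-\boldsymbol{X}^m(\rho_{j-1})|>0$) and each $f\in\mathbb{K}_p^h$ a function $\mathfrak{F}(f,\Gamma^m)$ on $\mathbb{I}$ with one-sided limits at the nodes. It models the flow with normal velocity $V_n=\mathfrak{F}(\mu)$, where $\mu$ is the weighted curvature, and is assumed dissipative: $(\mathfrak{F}(f,\Gamma^m),f)^h_{\Gamma^m}\le0$ for all $f\in\mathbb{K}_p^h$ and all non-degenerate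 closed polygonal curves $\Gamma^m$. Scheme (G): given $\boldsymbol{X}^0\in[\mathbb{K}_p^h]^2$, for $m\ge0$ find $(\boldsymbol{X}^{m+1},\mu^{m+1})\in[\mathbb{K}_p^h]^2\times\mathbb{K}_p^h$ such that $$\Bigl(\boldsymbol{n}^{m+\frac12}\cdot\tfrac{\boldsymbol{X}^{m+1}-\boldsymbol{X}^m}{\tau},\varphi^h\Bigr)^h_{\Gamma^m}-\bigl(\mathfrak{F}(\mu^{m+1},\Gamma^m),\varphi^h\bigr)^h_{\Gamma^m}=0\quad\forall\varphi^h\in\mathbb{K}_p^h,$$ $$\bigl(\mu^{m+1}\boldsymbol{n}^{m+\frac12},\boldsymbol{\omega}^h\bigr)^h_{\Gamma^m}-\bigl(\hat{\boldsymbol{G}}_k^\alpha(\theta^m)\partial_{s^m}\boldsymbol{X}^{m+1},\partial_{s^m}\boldsymbol{\omega}^h\bigr)^h_{\Gamma^m}=0\quad\forall\boldsymbol{\omega}^h\in[\mathbb{K}_p^h]^2 .$$ The area and energy are $$A^m=\frac12\sum_{j=1}^N\bigl(x^m(\rho_j)-x^m(\rho_{j-1})\bigr)\bigl(y^m(\rho_j)+y^m(\rho_{j-1})\bigr),\qquad W^m=\sum_{j=1}^N\hat\gamma(\theta_j^m)|\boldsymbol{h}_j^m| .$$ *)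

theory Defs
  imports "HOL-Analysis.Analysis"
begin

text \<open>
  Functions on the circle of length \<open>2 * pi\<close> are represented by \<open>2 * pi\<close>-periodic
  functions on the reals.
\<close>

definition C2_periodic :: "(real \<Rightarrow> real) \<Rightarrow> bool" where
  "C2_periodic g \<longleftrightarrow>
     periodic_fun_simple g (2 * pi) \<and>
     (\<forall>x. g differentiable (at x)) \<and>
     (\<forall>x. deriv g differentiable (at x)) \<and>
     continuous_on UNIV (deriv (deriv g))"

definition normal_vec :: "real \<Rightarrow> real^2" where
  "normal_vec \<theta> = vector [- sin \<theta>, cos \<theta>]"

definition tangent_vec :: "real \<Rightarrow> real^2" where
  "tangent_vec \<theta> = vector [cos \<theta>, sin \<theta>]"

definition perp :: "real^2 \<Rightarrow> real^2" where
  "perp v = vector [v $ 2, - (v $ 1)]"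

definition xi_vec :: "(real \<Rightarrow> real) \<Rightarrow> real \<Rightarrow> real^2" where
  "xi_vec \<gamma> \<theta> = \<gamma> \<theta> *\<^sub>R normal_vec \<theta> - deriv \<gamma> \<theta> *\<^sub>R tangent_vec \<theta>"

definition outer :: "real^2 \<Rightarrow> real^2 \<Rightarrow> real^2^2" where
  "outer u v = (\<chi> i j. u $ i * v $ j)"

definition surface_energy_matrix ::
    "(real \<Rightarrow> real) \<Rightarrow> real \<Rightarrow> (real \<Rightarrow> real) \<Rightarrow> real \<Rightarrow> real^2^2" where
  "surface_energy_matrix \<gamma> \<alpha> k \<theta> =
     \<gamma> \<theta> *\<^sub>R mat 1 - outer (normal_vec \<theta>) (xi_vec \<gamma> \<theta>)
     + \<alpha> *\<^sub>R outer (xi_vec \<gamma> \<theta>) (normal_vec \<theta>)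
     + k \<theta> *\<^sub>R outer (normal_vec \<theta>) (normal_vec \<theta>)"

definition node :: "nat \<Rightarrow> nat \<Rightarrow> real" where
  "node N j = real j / real N"

text \<open>
  Functions on the unit interval are total functions on the reals whose values outside
  \<open>{0..1}\<close> are irrelevant.
\<close>

definition Kp :: "nat \<Rightarrow> (real \<Rightarrow> real) set" where
  "Kp N = {u. continuous_on {0..1} u \<and> u 0 = u 1 \<and>
     (\<forall>j\<in>{1..N}. \<exists>a b. \<forall>x\<in>{node N (j - 1)..node N j}. u x = a + b * x)}"

definition Kp2 :: "nat \<Rightarrow> (real \<Rightarrow> real^2) set" where
  "Kp2 N = {U. \<forall>i. (\<lambda>x. U x $ i) \<in> Kp N}"

definition edge :: "nat \<Rightarrow> (real \<Rightarrow> real^2) \<Rightarrow> nat \<Rightarrow> real^2" where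
  "edge N X j = X (node N j) - X (node N (j - 1))"

definition closed_polygons :: "nat \<Rightarrow> (real \<Rightarrow> real^2) set" where
  "closed_polygons N = {X \<in> Kp2 N. \<forall>j\<in>{1..N}. norm (edge N X j) > 0}"

text \<open>
  The angle is determined modulo \<open>2 * pi\<close> only; it is used solely as an argument of
  \<open>2 * pi\<close>-periodic functions.
\<close>

definition edge_angle :: "nat \<Rightarrow> (real \<Rightarrow> real^2) \<Rightarrow> nat \<Rightarrow> real" where
  "edge_angle N X j =
     (SOME \<theta>. vector [cos \<theta>, sin \<theta>] = edge N X j /\<^sub>R norm (edge N X j))"

text \<open>
  Index \<open>j\<close> with \<open>\<rho> \<in> {node N (j - 1)..<node N j}\<close>. Piecewise constant
  functions enter the discrete inner product only through one-sided limits at the nodes, so the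
  choice made at the nodes themselves does not matter.
\<close>

definition cell :: "nat \<Rightarrow> real \<Rightarrow> nat" where
  "cell N \<rho> = nat \<lfloor>real N * \<rho>\<rfloor> + 1"

definition angle :: "nat \<Rightarrow> (real \<Rightarrow> real^2) \<Rightarrow> real \<Rightarrow> real" where
  "angle N X \<rho> = edge_angle N X (cell N \<rho>)"

definition arc_deriv ::
    "nat \<Rightarrow> (real \<Rightarrow> real^2) \<Rightarrow> (real \<Rightarrow> real^2) \<Rightarrow> real \<Rightarrow> real^2" where
  "arc_deriv N X f \<rho> =
     (let j = cell N \<rho> in (f (node N j) - f (node N (j - 1))) /\<^sub>R norm (edge N X j))"

definition mid_normal ::
    "nat \<Rightarrow> (real \<Rightarrow> real^2) \<Rightarrow> (real \<Rightarrow> real^2) \<Rightarrow> real \<Rightarrow> real^2" where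
  "mid_normal N X X' \<rho> =
     - ((1 / 2) *\<^sub>R perp (arc_deriv N X X \<rho> + arc_deriv N X X' \<rho>))"

definition has_one_sided_limits :: "nat \<Rightarrow> (real \<Rightarrow> real) \<Rightarrow> bool" where
  "has_one_sided_limits N u \<longleftrightarrow>
     (\<forall>j\<in>{1..N}. (\<exists>l. (u \<longlongrightarrow> l) (at_left (node N j))) \<and>
                 (\<exists>l. (u \<longlongrightarrow> l) (at_right (node N (j - 1)))))"

text \<open>The mass-lumped inner product; on the reals, \<open>(\<bullet>)\<close> is multiplication.\<close>

definition lumped_inner ::
    "nat \<Rightarrow> (real \<Rightarrow> real^2) \<Rightarrow> (real \<Rightarrow> 'a::real_inner) \<Rightarrow> (real \<Rightarrow> 'a) \<Rightarrow> real" where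
  "lumped_inner N X u v =
     (\<Sum>j=1..N. norm (edge N X j) / 2 *
        (Lim (at_left (node N j)) u \<bullet> Lim (at_left (node N j)) v
         + Lim (at_right (node N (j - 1))) u \<bullet> Lim (at_right (node N (j - 1))) v))"

text \<open>
  A velocity mapping takes a function in \<open>Kp N\<close> and a parametrisation of the curve. It is not
  required to ignore the values of these outside \<open>{0..1}\<close> or to be invariant under
  reparametrisation, so mappings of the curve alone are included.
\<close>

definition dissipative_velocity ::
    "nat \<Rightarrow> ((real \<Rightarrow> real) \<Rightarrow> (real \<Rightarrow> real^2) \<Rightarrow> real \<Rightarrow> real) \<Rightarrow> bool" where
  "dissipative_velocity N F \<longleftrightarrow>
     (\<forall>X\<in>closed_polygons N. \<forall>f\<in>Kp N.
        has_one_sided_limits N (F f X) \<and> lumped_inner N X (F f X) f \<le> 0)"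

text \<open>Here \<open>dt\<close> is the time step; \<open>\<mu> 0\<close> plays no role.\<close>

definition scheme_solution ::
    "nat \<Rightarrow> real \<Rightarrow> (real \<Rightarrow> real) \<Rightarrow> real \<Rightarrow> (real \<Rightarrow> real) \<Rightarrow>
     ((real \<Rightarrow> real) \<Rightarrow> (real \<Rightarrow> real^2) \<Rightarrow> real \<Rightarrow> real) \<Rightarrow>
     (nat \<Rightarrow> real \<Rightarrow> real^2) \<Rightarrow> (nat \<Rightarrow> real \<Rightarrow> real) \<Rightarrow> bool" where
  "scheme_solution N dt \<gamma> \<alpha> k F X \<mu> \<longleftrightarrow>
     (\<forall>m. X m \<in> closed_polygons N) \<and>
     (\<forall>m. \<mu> (Suc m) \<in> Kp N) \<and>
     (\<forall>m. \<forall>\<phi>\<in>Kp N.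
        lumped_inner N (X m)
          (\<lambda>\<rho>. mid_normal N (X m) (X (Suc m)) \<rho> \<bullet> ((X (Suc m) \<rho> - X m \<rho>) /\<^sub>R dt)) \<phi>
        - lumped_inner N (X m) (F (\<mu> (Suc m)) (X m)) \<phi> = 0) \<and>
     (\<forall>m. \<forall>\<omega>\<in>Kp2 N.
        lumped_inner N (X m) (\<lambda>\<rho>. \<mu> (Suc m) \<rho> *\<^sub>R mid_normal N (X m) (X (Suc m)) \<rho>) \<omega>
        - lumped_inner N (X m)
            (\<lambda>\<rho>. surface_energy_matrix \<gamma> \<alpha> k (angle N (X m) \<rho>)
                  *v arc_deriv N (X m) (X (Suc m)) \<rho>)
            (arc_deriv N (X m) \<omega>) = 0)"

definition area :: "nat \<Rightarrow> (real \<Rightarrow> real^2) \<Rightarrow> real" where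
  "area N X = 1 / 2 * (\<Sum>j=1..N. (X (node N j) $ 1 - X (node N (j - 1)) $ 1)
                               * (X (node N j) $ 2 + X (node N (j - 1)) $ 2))"

definition energy :: "nat \<Rightarrow> (real \<Rightarrow> real) \<Rightarrow> (real \<Rightarrow> real^2) \<Rightarrow> real" where
  "energy N \<gamma> X = (\<Sum>j=1..N. \<gamma> (edge_angle N X j) * norm (edge N X j))"

end

theory Submission
  imports Defs
begin

text \<open>
  Both conclusions come from choosing test functions. Testing the first equation of the scheme
  with the constant \<open>1\<close> turns the velocity term into the discrete flux of \<open>F\<close>;
  because the normal is averaged between the two time levels, the other term is exactly the
  increment of area, up to a sum that telescopes around the closed curve (\<open>area_difference\<close>).

  For the energy, the first equation is tested with \<open>\<mu> (Suc m)\<close> and the second with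
  \<open>X (Suc m) - X m\<close>. The curvature terms cancel, and dissipativity of \<open>F\<close> leaves
  \<open>(G \<partial>X', \<partial>(X' - X)) \<le> 0\<close>, where \<open>X = X m\<close>, \<open>X' = X (Suc m)\<close> and \<open>G\<close> is the
  surface energy matrix. It remains to bound the increment of energy by this product, which is
  possible edge by edge (\<open>edge_energy_estimate\<close>). Let an edge have length \<open>a\<close> and angle
  \<open>\<theta>\<close> before the step, and length \<open>r * a\<close> and angle \<open>\<theta> + \<delta>\<close> after it. After division by
  \<open>a\<close> the bound says that a quadratic polynomial \<open>P r\<^sup>2 - (Q + \<gamma> (\<theta> + \<delta>)) r + \<gamma> \<theta>\<close>
  is nonnegative; it is so if its discriminant is nonpositive, and
  this is a condition on \<open>\<theta>\<close>, \<open>\<delta>\<close> and \<open>k \<theta>\<close> alone, called \<open>stabilises\<close> below.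

  The parameter \<open>k \<theta>\<close> enters that condition with the factor \<open>4 \<gamma> \<theta> sin\<^sup>2 \<delta>\<close>, so a large
  \<open>k \<theta>\<close> helps except near the zeros of the sine. At \<open>\<delta> = 0\<close> the discriminant and its
  derivative both vanish, whence it is \<open>O(\<delta>\<^sup>2) = O(sin\<^sup>2 \<delta>)\<close>. At \<open>\<delta> = pi\<close> it equals
  \<open>- (3 \<gamma> \<theta> - \<gamma> (\<theta> + pi)) (\<gamma> \<theta> + \<gamma> (\<theta> + pi))\<close>. If \<open>3 \<gamma> \<theta> > \<gamma> (\<theta> + pi)\<close>, this is negative
  and nothing is required nearby. If equality holds, then \<open>\<theta>\<close> minimises
  \<open>3 \<gamma> - \<gamma> (\<cdot> + pi)\<close>, so \<open>\<gamma>' (\<theta> + pi) = 3 \<gamma>' \<theta>\<close>, and the derivative of the discriminant is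
  \<open>8 (\<alpha> + 1) \<gamma> \<theta> \<gamma>' \<theta>\<close>; this is where \<open>\<alpha> = -1\<close> makes the discriminant
  \<open>O(sin\<^sup>2 \<delta>)\<close> again. Compactness of a period turns the local bounds into one constant for
  each \<open>\<theta>\<close> (\<open>exists_stabilising_constant\<close>).
\<close>

section \<open>Bounding a function by a multiple of the squared sine\<close>

text \<open>
  Near a simple zero \<open>c\<close> the difference quotient of \<open>s\<close> exceeds half its limit, so
  \<open>s\<^sup>2\<close> controls \<open>(x - c)\<^sup>2\<close>. Applied to the sine below.
\<close>

lemma eventually_le_multiple_of_square:
  fixes s :: "real \<Rightarrow> real"
  assumes s: "(s has_real_derivative D) (at c)" and "s c = 0" "D \<noteq> 0"
  shows "\<forall>\<^sub>F x in nhds c. (x - c)\<^sup>2 \<le> (4 / D\<^sup>2) * (s x)\<^sup>2"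
proof -
  have lim: "((\<lambda>x. (s x - s c) / (x - c)) \<longlongrightarrow> D) (at c)"
    using s by (simp add: has_field_derivative_iff)
  have "\<forall>\<^sub>F x in at c. \<bar>D\<bar> / 2 < \<bar>(s x - s c) / (x - c)\<bar>"
    using order_tendstoD(1)[OF tendsto_rabs[OF lim], of "\<bar>D\<bar> / 2"] \<open>D \<noteq> 0\<close> by simp
  then have "\<forall>\<^sub>F x in at c. (x - c)\<^sup>2 \<le> (4 / D\<^sup>2) * (s x)\<^sup>2"
  proof (eventually_elim)
    case (elim x)
    show ?case
    proof (cases "x = c")
      case False
      have "\<bar>D\<bar> / 2 * \<bar>x - c\<bar> \<le> \<bar>s x\<bar>"
        using elim False \<open>s c = 0\<close> by (simp add: abs_divide field_simps)
      then have "(\<bar>D\<bar> / 2 * \<bar>x - c\<bar>)\<^sup>2 \<le> \<bar>s x\<bar>\<^sup>2"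
        by (intro power_mono) auto
      then show ?thesis
        using \<open>D \<noteq> 0\<close> by (simp add: power_mult_distrib power_divide field_simps)
    qed auto
  qed
  then show ?thesis
    unfolding eventually_at_filter by (rule eventually_mono) (use assms in auto)
qed

text \<open>
  Second-order Taylor bound needing the second derivative only at \<open>c\<close>: the difference
  quotient of \<open>f'\<close> gives \<open>\<bar>f' x\<bar> \<le> (\<bar>D\<bar> + 1) \<bar>x - c\<bar>\<close> near \<open>c\<close>, and the mean value
  theorem transfers this to \<open>f\<close>.
\<close>

lemma eventually_le_square_at_critical_zero:
  fixes f f' :: "real \<Rightarrow> real"
  assumes f: "\<And>x. (f has_real_derivative f' x) (at x)"
    and f': "(f' has_real_derivative D) (at c)"
    and "f c = 0" "f' c = 0"
  shows "\<forall>\<^sub>F x in nhds c. f x \<le> (\<bar>D\<bar> + 1) * (x - c)\<^sup>2"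
proof -
  have lim: "((\<lambda>x. (f' x - f' c) / (x - c)) \<longlongrightarrow> D) (at c)"
    using f' by (simp add: has_field_derivative_iff)
  have "\<forall>\<^sub>F x in at c. \<bar>(f' x - f' c) / (x - c)\<bar> < \<bar>D\<bar> + 1"
    using order_tendstoD(2)[OF tendsto_rabs[OF lim], of "\<bar>D\<bar> + 1"] by simp
  then obtain e where "e > 0"
    and e: "\<And>x. x \<noteq> c \<Longrightarrow> dist x c < e \<Longrightarrow> \<bar>(f' x - f' c) / (x - c)\<bar> < \<bar>D\<bar> + 1"
    unfolding eventually_at by auto
  have f'_le: "\<bar>f' x\<bar> \<le> (\<bar>D\<bar> + 1) * \<bar>x - c\<bar>" if "dist x c < e" for x
    using e[OF _ that] \<open>f' c = 0\<close> by (cases "x = c") (auto simp: abs_divide field_simps)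
  have "f x \<le> (\<bar>D\<bar> + 1) * (x - c)\<^sup>2" if x: "dist x c < e" for x
  proof -
    obtain z where z: "\<bar>z - c\<bar> \<le> \<bar>x - c\<bar>" and fx: "f x - f c = (x - c) * f' z"
    proof (cases x c rule: linorder_cases)
      case less
      obtain z where "x < z" "z < c" "f c - f x = (c - x) * f' z"
        using MVT2[OF less, of f f'] f by blast
      then show ?thesis by (intro that[of z]) (auto simp: algebra_simps)
    next
      case greater
      obtain z where "c < z" "z < x" "f x - f c = (x - c) * f' z"
        using MVT2[OF greater, of f f'] f by blast
      then show ?thesis by (intro that[of z]) auto
    qed (use that[of c] in auto)
    have "f x \<le> \<bar>x - c\<bar> * \<bar>f' z\<bar>"
      using fx \<open>f c = 0\<close> by (metis abs_ge_self abs_mult diff_zero)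
    also have "\<dots> \<le> \<bar>x - c\<bar> * ((\<bar>D\<bar> + 1) * \<bar>x - c\<bar>)"
      using f'_le[of z] z x mult_left_mono[OF z, of "\<bar>D\<bar> + 1"]
      by (intro mult_left_mono) (auto simp: dist_real_def)
    finally show ?thesis
      by (simp add: power2_eq_square mult_ac abs_mult_self_eq)
  qed
  then show ?thesis
    unfolding eventually_nhds_metric using \<open>e > 0\<close> by blast
qed

text \<open>
  The hypothesis on the zeros of the sine makes the bound hold near each point: away from those
  zeros \<open>f / sin\<^sup>2\<close> is continuous, at a zero with \<open>f < 0\<close> any constant works, and at a zero
  where \<open>f\<close> vanishes to second order the two preceding lemmas apply. Bolzano's bisection
  principle replaces a finite subcover: constants for adjacent intervals combine by \<open>max\<close>.
\<close>

lemma le_multiple_of_sin_squared_on_interval: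
  fixes f f' :: "real \<Rightarrow> real"
  assumes f: "\<And>x. (f has_real_derivative f' x) (at x)"
    and f': "\<And>x. f' differentiable (at x)"
    and zeros: "\<And>c. a \<le> c \<Longrightarrow> c \<le> b \<Longrightarrow> sin c = 0 \<Longrightarrow> f c < 0 \<or> f c = 0 \<and> f' c = 0"
    and "a \<le> b"
  shows "\<exists>K. \<forall>x. a \<le> x \<and> x \<le> b \<longrightarrow> f x \<le> K * (sin x)\<^sup>2"
proof -
  have local: "\<exists>K. \<forall>\<^sub>F x in nhds c. f x \<le> K * (sin x)\<^sup>2" if c: "a \<le> c" "c \<le> b" for c
  proof -
    have cont: "isCont f c"
      using f by (rule DERIV_isCont)
    consider "sin c \<noteq> 0" | "f c < 0" | "sin c = 0" "f c = 0" "f' c = 0"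
      using zeros[OF c] by blast
    then show ?thesis
    proof cases
      case 1
      have "isCont (\<lambda>x. f x / (sin x)\<^sup>2) c"
        using cont 1 by (intro continuous_intros) auto
      then have "((\<lambda>x. f x / (sin x)\<^sup>2) \<longlongrightarrow> f c / (sin c)\<^sup>2) (nhds c)"
        unfolding isCont_def
        by (rule tendsto_at_iff_tendsto_nhds[THEN iffD1, of "\<lambda>x. f x / (sin x)\<^sup>2" c])
      then have "\<forall>\<^sub>F x in nhds c. f x / (sin x)\<^sup>2 < f c / (sin c)\<^sup>2 + 1"
        by (rule order_tendstoD(2)) simp
      moreover have "\<forall>\<^sub>F x in nhds c. sin x \<noteq> 0"
        using 1 isCont_sin[of c]
        by (intro tendsto_imp_eventually_ne[where c = "sin c"])
           (auto simp: isCont_def tendsto_at_iff_tendsto_nhds)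
      ultimately have "\<forall>\<^sub>F x in nhds c. f x \<le> (f c / (sin c)\<^sup>2 + 1) * (sin x)\<^sup>2"
        by eventually_elim (simp add: divide_less_eq less_imp_le split: if_splits)
      then show ?thesis by blast
    next
      case 2
      have "(f \<longlongrightarrow> f c) (nhds c)"
        using cont by (simp add: isCont_def tendsto_at_iff_tendsto_nhds)
      then have "\<forall>\<^sub>F x in nhds c. f x < 0"
        using 2 by (rule order_tendstoD(2))
      then have "\<forall>\<^sub>F x in nhds c. f x \<le> 0 * (sin x)\<^sup>2"
        by eventually_elim simp
      then show ?thesis by blast
    next
      case 3
      obtain D where D: "(f' has_real_derivative D) (at c)"
        using f' by (auto simp: real_differentiable_def)
      have cos: "(cos c)\<^sup>2 = 1"
        using 3 sin_cos_squared_add[of c] by simp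
      have "\<forall>\<^sub>F x in nhds c. (x - c)\<^sup>2 \<le> (4 / (cos c)\<^sup>2) * (sin x)\<^sup>2"
        using 3 cos by (intro eventually_le_multiple_of_square DERIV_sin) auto
      with eventually_le_square_at_critical_zero[OF f D \<open>f c = 0\<close> \<open>f' c = 0\<close>]
      have "\<forall>\<^sub>F x in nhds c. f x \<le> ((\<bar>D\<bar> + 1) * 4) * (sin x)\<^sup>2"
      proof eventually_elim
        case (elim x)
        have "(\<bar>D\<bar> + 1) * (x - c)\<^sup>2 \<le> (\<bar>D\<bar> + 1) * (4 * (sin x)\<^sup>2)"
          using elim(2) cos by (intro mult_left_mono) auto
        with elim(1) show ?case by (simp only: mult.assoc)
      qed
      then show ?thesis by blast
    qed
  qed
  show ?thesis
  proof (rule Bolzano[OF \<open>a \<le> b\<close>])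
    fix p q r :: real
    assume "\<exists>K. \<forall>x. p \<le> x \<and> x \<le> q \<longrightarrow> f x \<le> K * (sin x)\<^sup>2"
      and "\<exists>K. \<forall>x. q \<le> x \<and> x \<le> r \<longrightarrow> f x \<le> K * (sin x)\<^sup>2"
    then obtain K L where "\<forall>x. p \<le> x \<and> x \<le> q \<longrightarrow> f x \<le> K * (sin x)\<^sup>2"
      and "\<forall>x. q \<le> x \<and> x \<le> r \<longrightarrow> f x \<le> L * (sin x)\<^sup>2"
      by blast
    moreover have "K * (sin x)\<^sup>2 \<le> max K L * (sin x)\<^sup>2" "L * (sin x)\<^sup>2 \<le> max K L * (sin x)\<^sup>2" for x
      by (auto intro: mult_right_mono)
    ultimately have "\<forall>x. p \<le> x \<and> x \<le> r \<longrightarrow> f x \<le> max K L * (sin x)\<^sup>2"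
      by (meson linear order_trans)
    then show "\<exists>K. \<forall>x. p \<le> x \<and> x \<le> r \<longrightarrow> f x \<le> K * (sin x)\<^sup>2" ..
  next
    fix c assume "a \<le> c" "c \<le> b"
    then obtain K d where "d > 0" and K: "\<And>x. dist x c < d \<Longrightarrow> f x \<le> K * (sin x)\<^sup>2"
      using local unfolding eventually_nhds_metric by blast
    then show "\<exists>d>0. \<forall>p q. p \<le> c \<and> c \<le> q \<and> q - p < d \<longrightarrow>
        (\<exists>K. \<forall>x. p \<le> x \<and> x \<le> q \<longrightarrow> f x \<le> K * (sin x)\<^sup>2)"
      by (intro exI[of _ d] conjI allI impI exI[of _ K] K) (auto simp: dist_real_def)
  qed
qed

section \<open>Stabilising constants\<close>

text \<open>
  Nonpositive discriminant of the quadratic polynomial in \<open>edge_energy_estimate\<close>, where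
  \<open>K\<close> stands for \<open>k \<theta>\<close> and \<open>\<delta>\<close> for the turning angle of an edge in one step.
\<close>

definition stabilises :: "(real \<Rightarrow> real) \<Rightarrow> real \<Rightarrow> real \<Rightarrow> real \<Rightarrow> bool" where
  "stabilises \<gamma> \<alpha> \<theta> K \<longleftrightarrow>
     (\<forall>\<delta>. (\<gamma> (\<theta> + \<delta>) + \<gamma> \<theta> * cos \<delta> - \<alpha> * deriv \<gamma> \<theta> * sin \<delta>)\<^sup>2 \<le>
        4 * \<gamma> \<theta> * (\<gamma> \<theta> + (\<alpha> - 1) * sin \<delta> * (\<gamma> \<theta> * sin \<delta> - deriv \<gamma> \<theta> * cos \<delta>)
           + K * (sin \<delta>)\<^sup>2))"

lemma stabilises_mono:
  assumes "stabilises \<gamma> \<alpha> \<theta> K" "K \<le> L" "\<gamma> \<theta> > 0"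
  shows "stabilises \<gamma> \<alpha> \<theta> L"
  unfolding stabilises_def
proof
  fix \<delta>
  have "4 * \<gamma> \<theta> * (\<gamma> \<theta> + (\<alpha> - 1) * sin \<delta> * (\<gamma> \<theta> * sin \<delta> - deriv \<gamma> \<theta> * cos \<delta>) + K * (sin \<delta>)\<^sup>2)
     \<le> 4 * \<gamma> \<theta> * (\<gamma> \<theta> + (\<alpha> - 1) * sin \<delta> * (\<gamma> \<theta> * sin \<delta> - deriv \<gamma> \<theta> * cos \<delta>) + L * (sin \<delta>)\<^sup>2)"
    using assms(2,3) by (intro mult_left_mono add_left_mono mult_right_mono) auto
  then show "(\<gamma> (\<theta> + \<delta>) + \<gamma> \<theta> * cos \<delta> - \<alpha> * deriv \<gamma> \<theta> * sin \<delta>)\<^sup>2 \<le>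
      4 * \<gamma> \<theta> * (\<gamma> \<theta> + (\<alpha> - 1) * sin \<delta> * (\<gamma> \<theta> * sin \<delta> - deriv \<gamma> \<theta> * cos \<delta>) + L * (sin \<delta>)\<^sup>2)"
    using assms(1) unfolding stabilises_def by (meson order_trans)
qed

lemma deriv_periodic:
  fixes g :: "real \<Rightarrow> real"
  assumes "\<And>x. g (x + p) = g x"
  shows "deriv g (x + p) = deriv g x"
proof -
  have "DERIV g (x + p) :> D \<longleftrightarrow> DERIV g x :> D" for D
    using DERIV_shift[of g D x p] assms by simp
  then show ?thesis
    by (simp add: deriv_def)
qed

text \<open>
  The discriminant without its \<open>K\<close> term, called \<open>H\<close> in the proof, must be bounded by a
  multiple of \<open>sin\<^sup>2\<close> on one period. At \<open>0\<close> it always vanishes to second order; at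
  \<open>pi\<close> it is negative, or it vanishes and the equation \<open>\<alpha> = -1\<close> gives second order.
\<close>

lemma exists_stabilising_constant:
  assumes C2: "C2_periodic \<gamma>" and pos: "\<And>\<theta>. \<gamma> \<theta> > 0"
    and cond: "(\<forall>\<theta>. 3 * \<gamma> \<theta> - \<gamma> (\<theta> - pi) > 0) \<or>
         (\<alpha> = -1 \<and> (\<forall>\<theta>. 3 * \<gamma> \<theta> - \<gamma> (\<theta> - pi) \<ge> 0))"
  shows "\<exists>K. stabilises \<gamma> \<alpha> \<theta> K"
proof -
  define \<gamma>' where "\<gamma>' = deriv \<gamma>"
  have per: "\<gamma> (x + 2 * pi) = \<gamma> x" for x
    using C2 periodic_fun_simple.plus_period unfolding C2_periodic_def by blast
  have d\<gamma>: "(\<gamma> has_real_derivative \<gamma>' x) (at x)" for x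
    using C2 unfolding C2_periodic_def \<gamma>'_def
    by (metis DERIV_imp_deriv real_differentiable_def)
  have d\<gamma>': "(\<gamma>' has_real_derivative deriv \<gamma>' x) (at x)" for x
    using C2 unfolding C2_periodic_def \<gamma>'_def
    by (metis DERIV_imp_deriv real_differentiable_def)
  have shift: "\<gamma> (x - pi) = \<gamma> (x + pi)" for x
    using per[of "x - pi"] by (simp add: add.commute)
  define g p where "g = \<gamma> \<theta>" and "p = \<gamma>' \<theta>"
  define H where "H = (\<lambda>x. (\<gamma> (\<theta> + x) + g * cos x - \<alpha> * p * sin x)\<^sup>2
      - 4 * g * (g + (\<alpha> - 1) * sin x * (g * sin x - p * cos x)))"
  define H' where "H' = (\<lambda>x. 2 * (\<gamma> (\<theta> + x) + g * cos x - \<alpha> * p * sin x)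
        * (\<gamma>' (\<theta> + x) - g * sin x - \<alpha> * p * cos x)
      - 4 * g * (\<alpha> - 1) * (cos x * (g * sin x - p * cos x) + sin x * (g * cos x + p * sin x)))"
  note [derivative_intros] = DERIV_chain2[OF d\<gamma>] DERIV_chain2[OF d\<gamma>']
  have dH: "(H has_real_derivative H' x) (at x)" for x
    unfolding H_def H'_def
    by (auto intro!: derivative_eq_intros simp: algebra_simps)
  have dH': "H' differentiable (at x)" for x
    unfolding H'_def real_differentiable_def
    by (rule exI) (rule derivative_eq_intros refl)+
  \<comment> \<open>This period is chosen so that both zeros of the sine lie in its interior.\<close>
  have "H c < 0 \<or> H c = 0 \<and> H' c = 0" if c: "- (pi / 2) \<le> c" "c \<le> 3 * pi / 2" "sin c = 0" for c
  proof -
    have "c = 0 \<or> c = pi"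
    proof (rule ccontr)
      assume ne: "\<not> ?thesis"
      consider "c < 0" | "0 < c" "c < pi" | "pi < c"
        using ne by linarith
      then show False
      proof cases
        case 1
        then show ?thesis
          using sin_gt_zero[of "- c"] c pi_gt_zero by auto
      next
        case 2
        then show ?thesis
          using sin_gt_zero[of c] c by auto
      next
        case 3
        then show ?thesis
          using sin_gt_zero[of "c - pi"] c pi_gt_zero by (auto simp: sin_diff)
      qed
    qed
    then show ?thesis
    proof
      assume "c = 0"
      then show ?thesis
        by (simp add: H_def H'_def g_def p_def power2_eq_square algebra_simps)
    next
      assume c: "c = pi"
      have H: "H pi = - (3 * g - \<gamma> (\<theta> + pi)) * (\<gamma> (\<theta> + pi) + g)"
        by (simp add: H_def power2_eq_square algebra_simps)
      have sum_pos: "\<gamma> (\<theta> + pi) + g > 0"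
        using pos by (simp add: g_def add_pos_pos)
      have "3 * g - \<gamma> (\<theta> + pi) \<ge> 0"
        using cond shift unfolding g_def by (metis less_imp_le)
      then consider "3 * g - \<gamma> (\<theta> + pi) > 0" | "3 * g - \<gamma> (\<theta> + pi) = 0"
        by linarith
      then show ?thesis
      proof cases
        case 1
        then show ?thesis
          using H sum_pos c by (simp add: mult_neg_pos)
      next
        case 2
        then have \<alpha>: "\<alpha> = -1" and nonneg: "\<And>t. 3 * \<gamma> t - \<gamma> (t + pi) \<ge> 0"
          using cond shift unfolding g_def by (metis less_irrefl)+
        \<comment> \<open>The function below is nonnegative and vanishes at \<open>\<theta>\<close>, hence has a minimum there.\<close>
        have "((\<lambda>t. 3 * \<gamma> t - \<gamma> (t + pi)) has_real_derivative 3 * p - \<gamma>' (\<theta> + pi)) (at \<theta>)"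
          unfolding p_def by (auto intro!: derivative_eq_intros)
        then have "3 * p - \<gamma>' (\<theta> + pi) = 0"
          using DERIV_local_min[of "\<lambda>t. 3 * \<gamma> t - \<gamma> (t + pi)" "3 * p - \<gamma>' (\<theta> + pi)" \<theta> 1]
            2 nonneg by (simp add: g_def)
        then have "\<gamma>' (\<theta> + pi) = 3 * p"
          by simp
        moreover have "\<gamma> (\<theta> + pi) = 3 * g"
          using 2 by simp
        ultimately have "H' pi = 0"
          by (simp add: H'_def \<alpha>)
        then show ?thesis
          using H 2 c by simp
      qed
    qed
  qed
  then obtain K where K: "\<And>x. - (pi / 2) \<le> x \<Longrightarrow> x \<le> 3 * pi / 2 \<Longrightarrow> H x \<le> K * (sin x)\<^sup>2"
    using le_multiple_of_sin_squared_on_interval[OF dH dH', of "- (pi / 2)" "3 * pi / 2"]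
    by auto
  have HK: "H x \<le> K * (sin x)\<^sup>2" for x
  proof -
    interpret periodic_fun_simple \<gamma> "2 * pi"
      using C2 unfolding C2_periodic_def by blast
    define i where "i = \<lfloor>(x + pi / 2) / (2 * pi)\<rfloor>"
    define y where "y = x - of_int i * (2 * pi)"
    have "of_int i \<le> (x + pi / 2) / (2 * pi)" "(x + pi / 2) / (2 * pi) < of_int i + 1"
      unfolding i_def by linarith+
    then have "- (pi / 2) \<le> y" "y \<le> 3 * pi / 2"
      unfolding y_def using pi_gt_zero by (auto simp: field_simps)
    then have "H y \<le> K * (sin y)\<^sup>2"
      by (rule K)
    moreover have x: "x = y + of_int i * (2 * pi)"
      unfolding y_def by simp
    have "sin x = sin y" "cos x = cos y" "\<gamma> (\<theta> + x) = \<gamma> (\<theta> + y)"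
      unfolding x
      using plus_of_int[of "\<theta> + y" i] sin.plus_of_int[of y i] cos.plus_of_int[of y i]
      by (simp_all add: add.assoc)
    then have "H x = H y" "sin x = sin y"
      by (simp_all add: H_def)
    ultimately show ?thesis by simp
  qed
  have "stabilises \<gamma> \<alpha> \<theta> (K / (4 * g))"
    unfolding stabilises_def
  proof
    fix x
    have "g > 0" using pos g_def by simp
    then show "(\<gamma> (\<theta> + x) + \<gamma> \<theta> * cos x - \<alpha> * deriv \<gamma> \<theta> * sin x)\<^sup>2 \<le>
        4 * \<gamma> \<theta> * (\<gamma> \<theta> + (\<alpha> - 1) * sin x * (\<gamma> \<theta> * sin x - deriv \<gamma> \<theta> * cos x)
           + K / (4 * g) * (sin x)\<^sup>2)"
      using HK[of x] unfolding H_def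
      by (simp add: distrib_left flip: g_def p_def \<gamma>'_def)
  qed
  then show ?thesis ..
qed


section \<open>The energy estimate on one edge\<close>

lemma surface_energy_matrix_mult:
  "surface_energy_matrix \<gamma> \<alpha> k \<theta> *v w =
     \<gamma> \<theta> *\<^sub>R w - (xi_vec \<gamma> \<theta> \<bullet> w) *\<^sub>R normal_vec \<theta>
     + (\<alpha> * (normal_vec \<theta> \<bullet> w)) *\<^sub>R xi_vec \<gamma> \<theta>
     + (k \<theta> * (normal_vec \<theta> \<bullet> w)) *\<^sub>R normal_vec \<theta>"
  by (simp add: surface_energy_matrix_def outer_def vec_eq_iff matrix_vector_mult_def
      inner_vec_def sum_2 forall_2 mat_def algebra_simps)

lemma inner_frame:
  "tangent_vec \<theta> \<bullet> tangent_vec \<phi> = cos (\<phi> - \<theta>)"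
  "normal_vec \<theta> \<bullet> tangent_vec \<phi> = sin (\<phi> - \<theta>)"
  by (simp_all add: tangent_vec_def normal_vec_def inner_vec_def sum_2 cos_diff sin_diff)

text \<open>
  Completing the square around the constant term \<open>g\<close> instead of the leading coefficient
  avoids having to know the sign of \<open>P\<close>.
\<close>

lemma quadratic_nonneg_of_discriminant:
  fixes P B g r :: real
  assumes "B\<^sup>2 \<le> 4 * g * P" "g > 0"
  shows "r\<^sup>2 * P - r * B + g \<ge> 0"
proof -
  have "4 * g * (r\<^sup>2 * P - r * B + g) = (2 * g - r * B)\<^sup>2 + r\<^sup>2 * (4 * g * P - B\<^sup>2)"
    by (simp add: power2_eq_square algebra_simps)
  also have "\<dots> \<ge> 0"
    using assms by simp
  finally show ?thesis
    using assms by (simp add: zero_le_mult_iff)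
qed

text \<open>
  In the frame \<open>(tangent_vec \<theta>, normal_vec \<theta>)\<close> the right-hand side becomes
  \<open>a (r\<^sup>2 P - r Q)\<close> with \<open>r = b / a\<close>, where \<open>P\<close> and \<open>Q\<close> are the products of
  \<open>G (tangent_vec \<phi>)\<close> with \<open>tangent_vec \<phi>\<close> and with \<open>tangent_vec \<theta>\<close>. The claim
  is then the nonnegativity of a quadratic polynomial in \<open>r\<close>.
\<close>

lemma edge_energy_estimate:
  assumes "stabilises \<gamma> \<alpha> \<theta> (k \<theta>)" "\<gamma> \<theta> > 0" "a > 0"
    and h: "h = a *\<^sub>R tangent_vec \<theta>" and h': "h' = b *\<^sub>R tangent_vec \<phi>"
  shows "\<gamma> \<phi> * b - \<gamma> \<theta> * a
     \<le> a * ((surface_energy_matrix \<gamma> \<alpha> k \<theta> *v (h' /\<^sub>R a)) \<bullet> ((h' - h) /\<^sub>R a))"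
proof -
  define \<delta> r where "\<delta> = \<phi> - \<theta>" and "r = b / a"
  define P where "P = \<gamma> \<theta> + (\<alpha> - 1) * sin \<delta> * (\<gamma> \<theta> * sin \<delta> - deriv \<gamma> \<theta> * cos \<delta>)
    + k \<theta> * (sin \<delta>)\<^sup>2"
  define Q where "Q = \<gamma> \<theta> * cos \<delta> - \<alpha> * deriv \<gamma> \<theta> * sin \<delta>"
  have "(Q + \<gamma> \<phi>)\<^sup>2 \<le> 4 * \<gamma> \<theta> * P"
    using assms(1)[unfolded stabilises_def, rule_format, of \<delta>]
    by (simp add: P_def Q_def \<delta>_def algebra_simps)
  then have nonneg: "r\<^sup>2 * P - r * (Q + \<gamma> \<phi>) + \<gamma> \<theta> \<ge> 0"
    using \<open>\<gamma> \<theta> > 0\<close> by (rule quadratic_nonneg_of_discriminant)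
  have w: "h' /\<^sub>R a = r *\<^sub>R tangent_vec \<phi>" "(h' - h) /\<^sub>R a = r *\<^sub>R tangent_vec \<phi> - tangent_vec \<theta>"
    using \<open>a > 0\<close> by (simp_all add: h h' r_def divide_inverse scaleR_diff_right mult.commute)
  have ip: "tangent_vec \<phi> \<bullet> tangent_vec \<phi> = 1" "tangent_vec \<theta> \<bullet> tangent_vec \<theta> = 1"
    "tangent_vec \<theta> \<bullet> tangent_vec \<phi> = cos \<delta>" "tangent_vec \<phi> \<bullet> tangent_vec \<theta> = cos \<delta>"
    "normal_vec \<theta> \<bullet> tangent_vec \<phi> = sin \<delta>" "normal_vec \<theta> \<bullet> tangent_vec \<theta> = 0"
    using inner_frame[of \<theta> \<phi>] inner_frame[of \<theta> \<theta>] inner_frame(1)[of \<phi> \<phi>]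
    by (simp_all add: \<delta>_def inner_commute)
  have "(surface_energy_matrix \<gamma> \<alpha> k \<theta> *v (h' /\<^sub>R a)) \<bullet> ((h' - h) /\<^sub>R a) = r\<^sup>2 * P - r * Q"
    unfolding w surface_energy_matrix_mult
    by (simp add: xi_vec_def inner_simps ip P_def Q_def power2_eq_square algebra_simps)
  moreover have "\<gamma> \<phi> * b - \<gamma> \<theta> * a \<le> a * (r\<^sup>2 * P - r * Q)"
  proof -
    have "b = a * r"
      using \<open>a > 0\<close> by (simp add: r_def)
    then have "a * (r\<^sup>2 * P - r * Q) - (\<gamma> \<phi> * b - \<gamma> \<theta> * a)
        = a * (r\<^sup>2 * P - r * (Q + \<gamma> \<phi>) + \<gamma> \<theta>)"
      by (simp add: algebra_simps)
    also have "\<dots> \<ge> 0"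
      using nonneg \<open>a > 0\<close> by simp
    finally show ?thesis by simp
  qed
  ultimately show ?thesis by simp
qed

lemma edge_eq_norm_tangent:
  assumes "edge N X j \<noteq> 0"
  shows "edge N X j = norm (edge N X j) *\<^sub>R tangent_vec (edge_angle N X j)"
proof -
  define v where "v = edge N X j /\<^sub>R norm (edge N X j)"
  have "norm v = 1"
    using assms by (simp add: v_def)
  then have "(v $ 1)\<^sup>2 + (v $ 2)\<^sup>2 = 1"
    by (simp add: norm_eq_1 inner_vec_def sum_2 power2_eq_square)
  then obtain t where "v $ 1 = cos t" "v $ 2 = sin t"
    by (rule sincos_total_2pi)
  then have "vector [cos t, sin t] = v"
    by (simp add: vec_eq_iff forall_2)
  then have "vector [cos (edge_angle N X j), sin (edge_angle N X j)] = v"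
    unfolding edge_angle_def v_def by (rule someI)
  then have "tangent_vec (edge_angle N X j) = v"
    by (simp add: tangent_vec_def)
  then show ?thesis
    using assms by (simp add: v_def)
qed

section \<open>Mass-lumped products of piecewise continuous functions\<close>

lemma node_bounds:
  assumes "j \<in> {1..N}"
  shows "0 \<le> node N (j - 1)" "node N (j - 1) < node N j" "node N j \<le> 1"
  using assms by (auto simp: node_def field_simps)

lemma cell_eq:
  assumes "j \<in> {1..N}" "node N (j - 1) < \<rho>" "\<rho> < node N j"
  shows "cell N \<rho> = j"
proof -
  have "real j - 1 < real N * \<rho>" "real N * \<rho> < real j"
    using assms by (auto simp: node_def field_simps of_nat_diff)
  then have "\<lfloor>real N * \<rho>\<rfloor> = int j - 1"
    by (intro floor_unique) auto
  then show ?thesis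
    using assms(1) by (auto simp: cell_def)
qed

lemma Lim_cell_ends:
  fixes u U :: "real \<Rightarrow> 'a::t2_space"
  assumes j: "j \<in> {1..N}" and U: "continuous_on {0..1} U"
    and eq: "\<And>\<rho>. node N (j - 1) < \<rho> \<Longrightarrow> \<rho> < node N j \<Longrightarrow> u \<rho> = U \<rho>"
  shows "Lim (at_left (node N j)) u = U (node N j)"
    and "Lim (at_right (node N (j - 1))) u = U (node N (j - 1))"
proof -
  have cont: "continuous_on {node N (j - 1)..node N j} U"
    using U by (rule continuous_on_subset) (use node_bounds[OF j] in auto)
  have less: "node N (j - 1) < node N j"
    using node_bounds[OF j] by simp
  have "\<forall>\<^sub>F \<rho> in at_left (node N j). U \<rho> = u \<rho>"
    by (rule eventually_at_leftI[OF _ less]) (simp add: eq)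
  with continuous_on_Icc_at_leftD[OF cont less]
  have "(u \<longlongrightarrow> U (node N j)) (at_left (node N j))"
    by (rule Lim_transform_eventually)
  then show "Lim (at_left (node N j)) u = U (node N j)"
    by (intro tendsto_Lim) auto
  have "\<forall>\<^sub>F \<rho> in at_right (node N (j - 1)). U \<rho> = u \<rho>"
    by (rule eventually_at_rightI[OF _ less]) (simp add: eq)
  with continuous_on_Icc_at_rightD[OF cont less]
  have "(u \<longlongrightarrow> U (node N (j - 1))) (at_right (node N (j - 1)))"
    by (rule Lim_transform_eventually)
  then show "Lim (at_right (node N (j - 1))) u = U (node N (j - 1))"
    by (intro tendsto_Lim) auto
qed

text \<open>
  Replaces the one-sided limits in the lumped product by point values. The families \<open>U\<close> and
  \<open>V\<close> extend each piece of \<open>u\<close> and \<open>v\<close> continuously to the closed cell, which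
  covers the piecewise constant and the continuous factors of the scheme alike.
\<close>

lemma lumped_inner_cellwise:
  fixes u v :: "real \<Rightarrow> 'a::real_inner"
  assumes U: "\<And>j. j \<in> {1..N} \<Longrightarrow> continuous_on {0..1} (U j)"
    and V: "\<And>j. j \<in> {1..N} \<Longrightarrow> continuous_on {0..1} (V j)"
    and u: "\<And>\<rho>. u \<rho> = U (cell N \<rho>) \<rho>"
    and v: "\<And>\<rho>. v \<rho> = V (cell N \<rho>) \<rho>"
  shows "lumped_inner N X u v = (\<Sum>j=1..N. norm (edge N X j) / 2 *
      (U j (node N j) \<bullet> V j (node N j) + U j (node N (j - 1)) \<bullet> V j (node N (j - 1))))"
  unfolding lumped_inner_def
proof (intro sum.cong refl)
  fix j assume j: "j \<in> {1..N}"
  have "u \<rho> = U j \<rho>" "v \<rho> = V j \<rho>" if "node N (j - 1) < \<rho>" "\<rho> < node N j" for \<rho>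
    using u v cell_eq[OF j that] by auto
  note Lim_cell_ends[OF j U[OF j] this(1)] Lim_cell_ends[OF j V[OF j] this(2)]
  then show "norm (edge N X j) / 2 *
        (Lim (at_left (node N j)) u \<bullet> Lim (at_left (node N j)) v
         + Lim (at_right (node N (j - 1))) u \<bullet> Lim (at_right (node N (j - 1))) v)
      = norm (edge N X j) / 2 *
      (U j (node N j) \<bullet> V j (node N j) + U j (node N (j - 1)) \<bullet> V j (node N (j - 1)))"
    by simp
qed

lemma Kp2_continuous:
  assumes "U \<in> Kp2 N"
  shows "continuous_on {0..1} U"
proof -
  have "continuous_on {0..1} (\<lambda>x. \<chi> i. U x $ i)"
    using assms by (intro continuous_on_vec_lambda) (simp add: Kp2_def Kp_def)
  then show ?thesis by simp
qed

lemma Kp_diff: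
  assumes "u \<in> Kp N" "v \<in> Kp N"
  shows "(\<lambda>x. u x - v x) \<in> Kp N"
proof -
  have "\<exists>a b. \<forall>x\<in>{node N (j - 1)..node N j}. u x - v x = a + b * x" if "j \<in> {1..N}" for j
  proof -
    obtain a b c d where "\<forall>x\<in>{node N (j - 1)..node N j}. u x = a + b * x"
      and "\<forall>x\<in>{node N (j - 1)..node N j}. v x = c + d * x"
      using assms \<open>j \<in> {1..N}\<close> unfolding Kp_def by blast
    then show ?thesis
      by (intro exI[of _ "a - c"] exI[of _ "b - d"]) (simp add: algebra_simps)
  qed
  then show ?thesis
    using assms by (auto simp: Kp_def intro!: continuous_intros)
qed

lemma Kp2_diff:
  assumes "U \<in> Kp2 N" "V \<in> Kp2 N"
  shows "(\<lambda>x. U x - V x) \<in> Kp2 N"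
  using assms by (auto simp: Kp2_def intro: Kp_diff)

lemma Kp_one: "(\<lambda>_. 1) \<in> Kp N"
  unfolding Kp_def by (intro CollectI conjI ballI exI[of _ 1] exI[of _ 0]) simp_all

section \<open>One time step\<close>

definition mid_normal_on :: "nat \<Rightarrow> (real \<Rightarrow> real^2) \<Rightarrow> (real \<Rightarrow> real^2) \<Rightarrow> nat \<Rightarrow> real^2" where
  "mid_normal_on N X X' j = - ((1 / 2) *\<^sub>R perp ((edge N X j + edge N X' j) /\<^sub>R norm (edge N X j)))"

lemma mid_normal_cell: "mid_normal N X X' \<rho> = mid_normal_on N X X' (cell N \<rho>)"
  by (simp add: mid_normal_def mid_normal_on_def arc_deriv_def Let_def scaleR_add_right edge_def)

lemma arc_deriv_cell: "arc_deriv N X U \<rho> = edge N U (cell N \<rho>) /\<^sub>R norm (edge N X (cell N \<rho>))"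
  by (simp add: arc_deriv_def edge_def Let_def)

lemma lumped_velocity_eq:
  assumes "X \<in> Kp2 N" "X' \<in> Kp2 N" "continuous_on {0..1} \<phi>"
  shows "lumped_inner N X (\<lambda>\<rho>. mid_normal N X X' \<rho> \<bullet> ((X' \<rho> - X \<rho>) /\<^sub>R dt)) \<phi> =
    (\<Sum>j=1..N. norm (edge N X j) / 2 *
       (\<phi> (node N j) * (mid_normal_on N X X' j \<bullet> (X' (node N j) - X (node N j)))
        + \<phi> (node N (j - 1)) *
            (mid_normal_on N X X' j \<bullet> (X' (node N (j - 1)) - X (node N (j - 1)))))) / dt"
proof -
  define M where "M = mid_normal_on N X X'"
  have "continuous_on {0..1} (\<lambda>\<rho>. M j \<bullet> ((X' \<rho> - X \<rho>) /\<^sub>R dt))" for j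
    by (intro continuous_intros Kp2_continuous[OF assms(1)] Kp2_continuous[OF assms(2)])
  then have "lumped_inner N X (\<lambda>\<rho>. mid_normal N X X' \<rho> \<bullet> ((X' \<rho> - X \<rho>) /\<^sub>R dt)) \<phi> =
    (\<Sum>j=1..N. norm (edge N X j) / 2 *
       ((M j \<bullet> ((X' (node N j) - X (node N j)) /\<^sub>R dt)) \<bullet> \<phi> (node N j)
        + (M j \<bullet> ((X' (node N (j - 1)) - X (node N (j - 1))) /\<^sub>R dt)) \<bullet> \<phi> (node N (j - 1))))"
    by (intro lumped_inner_cellwise[where
          U = "\<lambda>j \<rho>. M j \<bullet> ((X' \<rho> - X \<rho>) /\<^sub>R dt)" and V = "\<lambda>_. \<phi>"])
       (simp_all only: mid_normal_cell assms(3) M_def)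
  also have "\<dots> = (\<Sum>j=1..N. norm (edge N X j) / 2 *
       (\<phi> (node N j) * (M j \<bullet> (X' (node N j) - X (node N j)))
        + \<phi> (node N (j - 1)) * (M j \<bullet> (X' (node N (j - 1)) - X (node N (j - 1)))))) / dt"
  proof -
    have scale: "a / 2 * (inverse dt * x * p + inverse dt * y * q) = a / 2 * (p * x + q * y) / dt"
      for a x y p q :: real
      by (cases "dt = 0") (simp_all add: field_simps)
    show ?thesis
      by (simp only: sum_divide_distrib inner_scaleR_right inner_real_def scale)
  qed
  finally show ?thesis
    by (simp only: M_def)
qed

lemma lumped_curvature_eq:
  assumes "continuous_on {0..1} \<mu>" "continuous_on {0..1} \<omega>"
  shows "lumped_inner N X (\<lambda>\<rho>. \<mu> \<rho> *\<^sub>R mid_normal N X X' \<rho>) \<omega> =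
    (\<Sum>j=1..N. norm (edge N X j) / 2 *
       (\<mu> (node N j) * (mid_normal_on N X X' j \<bullet> \<omega> (node N j))
        + \<mu> (node N (j - 1)) * (mid_normal_on N X X' j \<bullet> \<omega> (node N (j - 1)))))"
  by (subst lumped_inner_cellwise[where
        U = "\<lambda>j \<rho>. \<mu> \<rho> *\<^sub>R mid_normal_on N X X' j" and V = "\<lambda>_. \<omega>"])
     (simp_all add: mid_normal_cell continuous_on_scaleR assms)

lemma lumped_stress_eq:
  "lumped_inner N X
      (\<lambda>\<rho>. surface_energy_matrix \<gamma> \<alpha> k (angle N X \<rho>) *v arc_deriv N X U \<rho>) (arc_deriv N X \<omega>) =
    (\<Sum>j=1..N. norm (edge N X j) *
       ((surface_energy_matrix \<gamma> \<alpha> k (edge_angle N X j) *v (edge N U j /\<^sub>R norm (edge N X j)))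
        \<bullet> (edge N \<omega> j /\<^sub>R norm (edge N X j))))"
  by (subst lumped_inner_cellwise[where
        U = "\<lambda>j \<rho>. surface_energy_matrix \<gamma> \<alpha> k (edge_angle N X j) *v
               (edge N U j /\<^sub>R norm (edge N X j))"
        and V = "\<lambda>j \<rho>. edge N \<omega> j /\<^sub>R norm (edge N X j)"])
     (simp_all add: arc_deriv_cell angle_def)

text \<open>
  Let \<open>d = X' - X\<close> and \<open>S = X' + X\<close>. Area is quadratic, so polarisation writes the
  contribution of an edge to \<open>area N X' - area N X\<close> through differences and sums of
  \<open>d\<close> and \<open>S\<close> over that edge, and a discrete product rule moves the difference from
  \<open>d\<close> to \<open>S\<close>. What remains is the product with the averaged normal, plus the increment
  along the edge of \<open>c = d\<^sub>1 S\<^sub>2 / 2\<close>; these increments sum to zero because the curve is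
  closed.
\<close>

lemma area_difference:
  assumes "X \<in> closed_polygons N" "X' \<in> closed_polygons N" "N > 0"
  shows "area N X' - area N X = (\<Sum>j=1..N. norm (edge N X j) / 2 *
       (mid_normal_on N X X' j \<bullet> (X' (node N j) - X (node N j))
        + mid_normal_on N X X' j \<bullet> (X' (node N (j - 1)) - X (node N (j - 1)))))"
proof -
  define A where "A = (\<lambda>(U :: real \<Rightarrow> real^2) j. (U (node N j) $ 1 - U (node N (j - 1)) $ 1)
      * (U (node N j) $ 2 + U (node N (j - 1)) $ (2::2)) / 2)"
  define c where "c = (\<lambda>j. (X' (node N j) $ 1 - X (node N j) $ 1)
      * (X' (node N j) $ 2 + X (node N j) $ (2::2)) / 2)"
  have area: "area N U = (\<Sum>j=1..N. A U j)" for U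
    by (simp add: area_def A_def sum_divide_distrib)
  have edge: "norm (edge N X j) / 2 *
       (mid_normal_on N X X' j \<bullet> (X' (node N j) - X (node N j))
        + mid_normal_on N X X' j \<bullet> (X' (node N (j - 1)) - X (node N (j - 1))))
      = A X' j - A X j - (c j - c (j - 1))" if j: "j \<in> {1..N}" for j
  proof -
    have "norm (edge N X j) > 0"
      using assms(1) j by (simp add: closed_polygons_def)
    then show ?thesis
      by (simp add: mid_normal_on_def perp_def edge_def inner_vec_def sum_2 A_def c_def field_simps)
  qed
  have "(\<Sum>j=1..N. c j - c (j - 1)) = 0"
  proof -
    have "X 0 = X 1" "X' 0 = X' 1"
      using assms by (auto simp: closed_polygons_def Kp2_def Kp_def vec_eq_iff)
    then have "c N = c 0"
      using \<open>N > 0\<close> by (simp add: c_def node_def)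
    then show ?thesis
      using sum_telescope''[of 0 N c] by simp
  qed
  then have "area N X' - area N X = (\<Sum>j=1..N. A X' j - A X j - (c j - c (j - 1)))"
    by (simp only: area sum_subtractf)
  also note sum.cong[OF refl edge, symmetric]
  finally show ?thesis .
qed

lemma energy_decrease:
  assumes "X \<in> closed_polygons N" "X' \<in> closed_polygons N"
    and "\<And>\<theta>. \<gamma> \<theta> > 0" "\<And>\<theta>. stabilises \<gamma> \<alpha> \<theta> (k \<theta>)"
  shows "energy N \<gamma> X' - energy N \<gamma> X \<le> lumped_inner N X
      (\<lambda>\<rho>. surface_energy_matrix \<gamma> \<alpha> k (angle N X \<rho>) *v arc_deriv N X X' \<rho>)
      (arc_deriv N X (\<lambda>\<rho>. X' \<rho> - X \<rho>))"
  unfolding energy_def lumped_stress_eq sum_subtractf[symmetric]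
proof (rule sum_mono)
  fix j assume j: "j \<in> {1..N}"
  have pos: "norm (edge N X j) > 0" "norm (edge N X' j) > 0"
    using assms(1,2) j by (auto simp: closed_polygons_def)
  then have nz: "edge N X j \<noteq> 0" "edge N X' j \<noteq> 0"
    by auto
  have "edge N (\<lambda>\<rho>. X' \<rho> - X \<rho>) j = edge N X' j - edge N X j"
    by (simp add: edge_def)
  then show "\<gamma> (edge_angle N X' j) * norm (edge N X' j) - \<gamma> (edge_angle N X j) * norm (edge N X j)
    \<le> norm (edge N X j) *
       ((surface_energy_matrix \<gamma> \<alpha> k (edge_angle N X j) *v (edge N X' j /\<^sub>R norm (edge N X j)))
        \<bullet> (edge N (\<lambda>\<rho>. X' \<rho> - X \<rho>) j /\<^sub>R norm (edge N X j)))"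
    using edge_energy_estimate[of \<gamma> \<alpha> "edge_angle N X j" k,
        OF assms(4,3) pos(1) edge_eq_norm_tangent[OF nz(1)] edge_eq_norm_tangent[OF nz(2)]]
    by (simp only:)
qed

context
  fixes N :: nat and dt \<alpha> :: real and \<gamma> k F X \<mu>
  assumes N: "N > 0" and dt: "dt > 0" and sol: "scheme_solution N dt \<gamma> \<alpha> k F X \<mu>"
begin

lemma solution_polygon: "X m \<in> closed_polygons N" "X m \<in> Kp2 N"
proof -
  show "X m \<in> closed_polygons N"
    using sol unfolding scheme_solution_def by blast
  then show "X m \<in> Kp2 N"
    unfolding closed_polygons_def by blast
qed

lemma solution_velocity:
  "\<phi> \<in> Kp N \<Longrightarrow> lumped_inner N (X m)
     (\<lambda>\<rho>. mid_normal N (X m) (X (Suc m)) \<rho> \<bullet> ((X (Suc m) \<rho> - X m \<rho>) /\<^sub>R dt)) \<phi>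
   = lumped_inner N (X m) (F (\<mu> (Suc m)) (X m)) \<phi>"
  by (rule sol[unfolded scheme_solution_def right_minus_eq, THEN conjunct2, THEN conjunct2,
        THEN conjunct1, rule_format])

lemma solution_curvature:
  "\<omega> \<in> Kp2 N \<Longrightarrow> lumped_inner N (X m)
     (\<lambda>\<rho>. surface_energy_matrix \<gamma> \<alpha> k (angle N (X m) \<rho>) *v arc_deriv N (X m) (X (Suc m)) \<rho>)
     (arc_deriv N (X m) \<omega>)
   = lumped_inner N (X m) (\<lambda>\<rho>. \<mu> (Suc m) \<rho> *\<^sub>R mid_normal N (X m) (X (Suc m)) \<rho>) \<omega>"
  by (rule sol[unfolded scheme_solution_def right_minus_eq, THEN conjunct2, THEN conjunct2,
        THEN conjunct2, rule_format, symmetric])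

lemma area_balance:
  "(area N (X (Suc m)) - area N (X m)) / dt = lumped_inner N (X m) (F (\<mu> (Suc m)) (X m)) (\<lambda>_. 1)"
  unfolding solution_velocity[OF Kp_one, symmetric]
    lumped_velocity_eq[OF solution_polygon(2) solution_polygon(2) continuous_on_const]
    area_difference[OF solution_polygon(1) solution_polygon(1) N]
  by (simp only: mult_1)

text \<open>
  The test functions \<open>\<mu> (Suc m)\<close> and \<open>X (Suc m) - X m\<close> make the curvature term of the
  second equation equal to \<open>dt\<close> times the displacement term of the first, so the two
  equations can be chained.
\<close>

lemma energy_step:
  assumes F: "dissipative_velocity N F"
    and \<gamma>: "\<And>\<theta>. \<gamma> \<theta> > 0" "\<And>\<theta>. stabilises \<gamma> \<alpha> \<theta> (k \<theta>)"
  shows "energy N \<gamma> (X (Suc m)) \<le> energy N \<gamma> (X m)"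
proof -
  let ?\<mu> = "\<mu> (Suc m)" and ?\<omega> = "\<lambda>\<rho>. X (Suc m) \<rho> - X m \<rho>"
  have \<mu>: "?\<mu> \<in> Kp N"
    using sol by (simp add: scheme_solution_def)
  have \<omega>: "?\<omega> \<in> Kp2 N"
    by (intro Kp2_diff solution_polygon)
  have cont: "continuous_on {0..1} ?\<mu>" "continuous_on {0..1} ?\<omega>"
    using \<mu> Kp2_continuous[OF \<omega>] by (simp_all add: Kp_def)
  have "energy N \<gamma> (X (Suc m)) - energy N \<gamma> (X m) \<le> lumped_inner N (X m)
      (\<lambda>\<rho>. surface_energy_matrix \<gamma> \<alpha> k (angle N (X m) \<rho>) *v arc_deriv N (X m) (X (Suc m)) \<rho>)
      (arc_deriv N (X m) ?\<omega>)"
    by (intro energy_decrease solution_polygon \<gamma>)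
  also have "\<dots> = lumped_inner N (X m) (\<lambda>\<rho>. ?\<mu> \<rho> *\<^sub>R mid_normal N (X m) (X (Suc m)) \<rho>) ?\<omega>"
    by (rule solution_curvature[OF \<omega>])
  also have "\<dots> = dt * lumped_inner N (X m)
      (\<lambda>\<rho>. mid_normal N (X m) (X (Suc m)) \<rho> \<bullet> ((X (Suc m) \<rho> - X m \<rho>) /\<^sub>R dt)) ?\<mu>"
    unfolding lumped_curvature_eq[OF cont]
      lumped_velocity_eq[OF solution_polygon(2) solution_polygon(2) cont(1)]
    using dt by simp
  also have "\<dots> = dt * lumped_inner N (X m) (F ?\<mu> (X m)) ?\<mu>"
    by (simp only: solution_velocity[OF \<mu>])
  also have "\<dots> \<le> 0"
  proof (rule mult_nonneg_nonpos)
    show "lumped_inner N (X m) (F ?\<mu> (X m)) ?\<mu> \<le> 0"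
      using F \<mu> solution_polygon(1)[of m] unfolding dissipative_velocity_def by blast
  qed (use dt in simp)
  finally show ?thesis by simp
qed

end

text \<open>
  A constant for the two conclusions, because \<open>X (Suc m)\<close> with a schematic \<open>X\<close> is not a
  higher-order pattern and makes the introduction of the outer quantifiers intractable.
\<close>

definition structure_preserving where
  "structure_preserving N dt \<gamma> F X \<mu> \<longleftrightarrow>
     (\<forall>m. (area N (X (Suc m)) - area N (X m)) / dt
            = lumped_inner N (X m) (F (\<mu> (Suc m)) (X m)) (\<lambda>_. 1)) \<and>
     (\<forall>m. \<forall>l\<le>m. energy N \<gamma> (X (Suc l)) \<le> energy N \<gamma> (X l))"

theorem theorem5p3:
  fixes \<alpha> :: real and \<gamma> :: "real \<Rightarrow> real"
  assumes "C2_periodic \<gamma>"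
    and "\<forall>\<theta>. \<gamma> \<theta> > 0"
    and "(\<forall>\<theta>. 3 * \<gamma> \<theta> - \<gamma> (\<theta> - pi) > 0) \<or>
         (\<alpha> = -1 \<and> (\<forall>\<theta>. 3 * \<gamma> \<theta> - \<gamma> (\<theta> - pi) \<ge> 0))"
  shows "\<exists>kstar :: real \<Rightarrow> real. periodic_fun_simple kstar (2 * pi) \<and>
    (\<forall>(k :: real \<Rightarrow> real) (N :: nat) (dt :: real)
        (F :: (real \<Rightarrow> real) \<Rightarrow> (real \<Rightarrow> real^2) \<Rightarrow> real \<Rightarrow> real)
        (X :: nat \<Rightarrow> real \<Rightarrow> real^2) (\<mu> :: nat \<Rightarrow> real \<Rightarrow> real).
       periodic_fun_simple k (2 * pi) \<longrightarrow> (\<forall>\<theta>. k \<theta> \<ge> kstar \<theta>) \<longrightarrow>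
       N > 2 \<longrightarrow> dt > 0 \<longrightarrow> dissipative_velocity N F \<longrightarrow>
       scheme_solution N dt \<gamma> \<alpha> k F X \<mu> \<longrightarrow>
       (\<forall>m. (area N (X (Suc m)) - area N (X m)) / dt
              = lumped_inner N (X m) (F (\<mu> (Suc m)) (X m)) (\<lambda>_. 1)) \<and>
       (\<forall>m. \<forall>l\<le>m. energy N \<gamma> (X (Suc l)) \<le> energy N \<gamma> (X l)))"
proof -
  have pos: "\<gamma> \<theta> > 0" for \<theta>
    using assms(2) by blast
  \<comment> \<open>The set of stabilising constants is \<open>2 * pi\<close>-periodic in \<open>\<theta>\<close>, hence so is any choice
    that depends on nothing but this set.\<close>
  define kstar where "kstar = (\<lambda>\<theta>. SOME K. stabilises \<gamma> \<alpha> \<theta> K)"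
  have kstar: "stabilises \<gamma> \<alpha> \<theta> (kstar \<theta>)" for \<theta>
    unfolding kstar_def
    by (rule someI_ex[OF exists_stabilising_constant[OF assms(1) pos assms(3)]])
  have per: "\<gamma> (x + 2 * pi) = \<gamma> x" for x
    using assms(1) periodic_fun_simple.plus_period unfolding C2_periodic_def by blast
  have "stabilises \<gamma> \<alpha> (\<theta> + 2 * pi) = stabilises \<gamma> \<alpha> \<theta>" for \<theta>
  proof -
    have "\<gamma> (\<theta> + 2 * pi + \<delta>) = \<gamma> (\<theta> + \<delta>)" for \<delta>
      using per[of "\<theta> + \<delta>"] by (simp add: ac_simps)
    then show ?thesis
      by (simp add: stabilises_def fun_eq_iff per deriv_periodic[of \<gamma> "2 * pi", OF per])
  qed
  then have kstar_periodic: "periodic_fun_simple kstar (2 * pi)"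
    by unfold_locales (simp add: kstar_def)
  have "structure_preserving N dt \<gamma> F X \<mu>"
    if k: "\<forall>\<theta>. k \<theta> \<ge> kstar \<theta>" and "N > 2" and dt: "dt > 0"
      and F: "dissipative_velocity N F" and sol: "scheme_solution N dt \<gamma> \<alpha> k F X \<mu>"
    for k N dt F X \<mu>
  proof -
    have N: "N > 0"
      using \<open>N > 2\<close> by simp
    have "stabilises \<gamma> \<alpha> \<theta> (k \<theta>)" for \<theta>
      using k by (intro stabilises_mono[of \<gamma> \<alpha> \<theta> "kstar \<theta>" "k \<theta>"] kstar pos) simp
    note area_balance[OF N dt sol] energy_step[OF N dt sol F pos this]
    then show ?thesis
      unfolding structure_preserving_def by (intro conjI allI impI)
  qed
  with kstar_periodic have "\<exists>kstar. periodic_fun_simple kstar (2 * pi) \<and>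
    (\<forall>k N dt F X \<mu>. periodic_fun_simple k (2 * pi) \<longrightarrow> (\<forall>\<theta>. k \<theta> \<ge> kstar \<theta>) \<longrightarrow>
       N > 2 \<longrightarrow> dt > 0 \<longrightarrow> dissipative_velocity N F \<longrightarrow>
       scheme_solution N dt \<gamma> \<alpha> k F X \<mu> \<longrightarrow> structure_preserving N dt \<gamma> F X \<mu>)"
    by (intro exI[of _ kstar] conjI allI impI)
  then show ?thesis
    unfolding structure_preserving_def .
qed

end
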